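(* Let $\mathfrak{g}$ be a Lie algebra over a field $\mathbb{K}$ of characteristic not $2$, let $\lambda\in\mathrm{End}(\mathfrak{g})$ and $s\in\mathfrak{g}$, and put $\kappa=2\lambda$. Assume that $\lambda([a,b])=[\lambda(a),b]+[a,\lambda(b)]-[a,\kappa(b)]$ for all $a,b\in\mathfrak{g}$, that $[x,\lambda(y)]=0$ for all $x,y\in\mathfrak{g}$, and that $\mathrm{ad}_s=0$. Let $\mathfrak{a}=\mathfrak{a}(\mathfrak{g};\kappa=2\lambda,\lambda,s)$ be the associated Lie affgebra. If all elements of $\mathfrak{a}$ are affinely ad-nilpotent, then $\mathfrak{a}$ is an affinely nilpotent Lie affgebra.
   Context: For a Lie algebra $(\mathfrak{g},[-,-])$ over $\mathbb{K}$, $\mathbb{K}$-linear maps $\kappa,\lambda:\mathfrak{g}\to\mathfrak{g}$ with $\lambda([a,b])=[\lambda(a),b]+[a,\lambda(b)]-[a,\kappa(b)]$ for all $a,b\in\mathfrak{g}$, and $s\in\mathfrak{g}$, the Lie affgebra $\mathfrak{a}(\mathfrak{g};\kappa,\lambda,s)$ is the set $\mathfrak{g}$ with its affine space structure $\langle a,b,c\rangle=a-b+c$, $\alpha\triangleright_a b=(1-\alpha)a+\alpha b$ ($\alpha\in\mathbb{K}$), and the affine Lie bracket $\{a,b\}=[a,b]+\kappa(a)+\lambda(b-a)+s$. Here $\mathrm{ad}_a(x)=[a,x]$. Set $E:=\{x\in\mathfrak{a}\mid \{x,a\}=\{a,x\}=x \text{ for all } a\in\mathfrak{a}\}$; this set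 is either empty or a singleton. For affine subspaces $\mathfrak{b},\mathfrak{c}$ of $\mathfrak{a}$, $\{\mathfrak{b},\mathfrak{c}\}$ denotes the smallest affine subspace of $\mathfrak{a}$ containing all $\{x,y\}$ with $x\in\mathfrak{b}$, $y\in\mathfrak{c}$. Put $\mathfrak{a}^{(0)}=\mathfrak{a}$ and $\mathfrak{a}^{(m)}=\{\mathfrak{a},\mathfrak{a}^{(m-1)}\}$ for $m\ge 1$. The Lie affgebra $\mathfrak{a}$ is affinely nilpotent if there is a positive integer $n$ with $\mathfrak{a}^{(n+k)}=\mathfrak{a}^{(n)}=E$ for all $k\in\mathbb{N}$. For $a\in\mathfrak{a}$ let $\mathrm{ad}^{aff}_a:\mathfrak{a}\to\mathfrak{a}$, $\mathrm{ad}^{aff}_a(b)=\{a,b\}$. The element $a$ is affinely ad-nilpotent if there is a natural number $n$ such that, for all $x\in\mathfrak{a}$ and all $k\in\mathbb{N}$, $(\mathrm{ad}^{aff}_a)^{n+k}(x)=(\mathrm{ad}^{aff}_a)^{n}(x)=e$, where $E=\{e\}$ (in particular $E\neq\emptyset$).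
   Formalization: The Lie algebra is additionally assumed finite-dimensional; without this the claim fails, e.g. for the direct sum over n of the strictly upper triangular n×n matrices with λ=0, s=0. *)

theory Defs
  imports Complex_Main
begin

locale lie_algebra = vector_space scale
  for scale :: "'k::field \<Rightarrow> 'g::ab_group_add \<Rightarrow> 'g" +
  fixes br :: "'g \<Rightarrow> 'g \<Rightarrow> 'g"
  assumes linear_right: "Vector_Spaces.linear scale scale (\<lambda>y. br x y)"
    and linear_left: "Vector_Spaces.linear scale scale (\<lambda>x. br x y)"
    and alternating: "br x x = 0"
    and jacobi: "br x (br y z) + br y (br z x) + br z (br x y) = 0"

definition ad :: "('g \<Rightarrow> 'g \<Rightarrow> 'g) \<Rightarrow> 'g \<Rightarrow> 'g \<Rightarrow> 'g" where
  "ad br a = (\<lambda>x. br a x)"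

text \<open>The operations of a Lie affgebra on the whole type \<open>'a\<close>: the ternary operation
  \<open>\<langle>a,b,c\<rangle>\<close>, the action \<open>\<alpha> \<triangleright>\<^sub>a b\<close> (arguments in the order \<open>\<alpha>, a, b\<close>) and the bracket
  \<open>{a,b}\<close>.\<close>

record ('k, 'a) affgebra =
  heap :: "'a \<Rightarrow> 'a \<Rightarrow> 'a \<Rightarrow> 'a"
  act :: "'k \<Rightarrow> 'a \<Rightarrow> 'a \<Rightarrow> 'a"
  bracket :: "'a \<Rightarrow> 'a \<Rightarrow> 'a"

definition affgebra_of ::
  "('k::field \<Rightarrow> 'g::ab_group_add \<Rightarrow> 'g) \<Rightarrow> ('g \<Rightarrow> 'g \<Rightarrow> 'g) \<Rightarrow> ('g \<Rightarrow> 'g) \<Rightarrow> ('g \<Rightarrow> 'g) \<Rightarrow> 'g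
    \<Rightarrow> ('k, 'g) affgebra" where
  "affgebra_of scale br \<kappa> lam s =
    \<lparr> heap = (\<lambda>a b c. a - b + c),
      act = (\<lambda>\<alpha> a b. scale (1 - \<alpha>) a + scale \<alpha> b),
      bracket = (\<lambda>a b. br a b + \<kappa> a + lam (b - a) + s) \<rparr>"

text \<open>The empty set counts as an affine subspace. This does not affect hulls of nonempty sets,
  and every term of the series below is nonempty.\<close>

definition affine_subspace :: "('k, 'a) affgebra \<Rightarrow> 'a set \<Rightarrow> bool" where
  "affine_subspace A S \<longleftrightarrow>
    (\<forall>a\<in>S. \<forall>b\<in>S. \<forall>c\<in>S. heap A a b c \<in> S) \<and>
    (\<forall>\<alpha>. \<forall>a\<in>S. \<forall>b\<in>S. act A \<alpha> a b \<in> S)"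

definition set_bracket :: "('k, 'a) affgebra \<Rightarrow> 'a set \<Rightarrow> 'a set \<Rightarrow> 'a set" where
  "set_bracket A B C = affine_subspace A hull {bracket A x y | x y. x \<in> B \<and> y \<in> C}"

fun lower_series :: "('k, 'a) affgebra \<Rightarrow> nat \<Rightarrow> 'a set" where
  "lower_series A 0 = UNIV"
| "lower_series A (Suc m) = set_bracket A UNIV (lower_series A m)"

definition absorbing :: "('k, 'a) affgebra \<Rightarrow> 'a set" where
  "absorbing A = {x. \<forall>a. bracket A x a = x \<and> bracket A a x = x}"

definition affinely_nilpotent :: "('k, 'a) affgebra \<Rightarrow> bool" where
  "affinely_nilpotent A \<longleftrightarrow>
    (\<exists>n>0. \<forall>k. lower_series A (n + k) = lower_series A n \<and> lower_series A n = absorbing A)"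

definition ad_aff :: "('k, 'a) affgebra \<Rightarrow> 'a \<Rightarrow> 'a \<Rightarrow> 'a" where
  "ad_aff A a = (\<lambda>b. bracket A a b)"

definition affinely_ad_nilpotent :: "('k, 'a) affgebra \<Rightarrow> 'a \<Rightarrow> bool" where
  "affinely_ad_nilpotent A a \<longleftrightarrow>
    (\<exists>e. absorbing A = {e} \<and>
      (\<exists>n. \<forall>x k. (ad_aff A a ^^ (n + k)) x = (ad_aff A a ^^ n) x \<and> (ad_aff A a ^^ n) x = e))"

end

theory Submission
  imports Defs
begin

text \<open>If \<open>E\<close> contains \<open>x\<close>, comparing \<open>{x, a} = x = {a, x}\<close> with the same equations at \<open>a = 0\<close>
  gives \<open>2 \<lambda>(a) = 0\<close>, so \<open>\<lambda> = 0\<close>, the bracket is \<open>[a, b] + s\<close> and \<open>E = {s}\<close>. As \<open>s\<close> is central,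
  affine ad-nilpotency is ordinary ad-nilpotency and the affine lower central series is the
  translate by \<open>s\<close> of the linear one, so Engel's theorem applies. For the latter, take a maximal
  subspace \<open>H\<close> acting nilpotently. If \<open>H\<close> is proper, there is \<open>x \<notin> H\<close> with \<open>[H, x] \<subseteq> H\<close>, and then
  \<open>ad x\<close> preserves each \<open>V\<^sub>i = H \<cdot> (\<dots> (H \<cdot> g))\<close> and \<open>H + \<langle>x\<rangle>\<close> maps \<open>V\<^sub>i\<^sub>+\<^sub>1 + (ad x)\<^sup>j V\<^sub>i\<close> into
  \<open>V\<^sub>i\<^sub>+\<^sub>1 + (ad x)\<^sup>j\<^sup>+\<^sup>1 V\<^sub>i\<close>, so \<open>H + \<langle>x\<rangle>\<close> still acts nilpotently.\<close>

context lie_algebra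
begin

section \<open>Elementary identities for the bracket\<close>

lemma br_add_right: "br x (y + z) = br x y + br x z"
  using linear_right by (simp add: Vector_Spaces.linear_iff)

lemma br_scale_right: "br x (scale c y) = scale c (br x y)"
  using linear_right by (simp add: Vector_Spaces.linear_iff)

lemma br_add_left: "br (x + y) z = br x z + br y z"
  using linear_left by (simp add: Vector_Spaces.linear_iff)

lemma br_scale_left: "br (scale c x) y = scale c (br x y)"
  using linear_left by (simp add: Vector_Spaces.linear_iff)

lemma br_zero_right [simp]: "br x 0 = 0"
  using br_add_right[of x 0 0] by simp

lemma br_zero_left [simp]: "br 0 x = 0"
  using br_add_left[of 0 0 x] by simp

lemma br_anticomm: "br x y = - br y x"
proof -
  have "br x y + br y x = 0"
    using alternating[of "x + y"]
    by (simp add: br_add_left br_add_right alternating[of x] alternating[of y] add.commute)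
  then show ?thesis
    by (simp add: eq_neg_iff_add_eq_0)
qed

lemma br_minus_right: "br x (- y) = - br x y"
  using br_add_right[of x y "- y"] by (simp add: eq_neg_iff_add_eq_0 add.commute)

text \<open>The Jacobi identity, turned by anticommutativity into the Leibniz rule for
  \<open>br x\<close>; in this form it moves \<open>x\<close> past the elements of
  \<open>H\<close>.\<close>

lemma br_derivation: "br x (br y z) = br (br x y) z + br y (br x z)"
proof -
  have "br z (br x y) = - br (br x y) z" "br y (br z x) = - br y (br x z)"
    using br_anticomm br_minus_right by metis+
  then show ?thesis
    using jacobi[of x y z] by (simp add: algebra_simps)
qed

section \<open>Iterated action of a set of elements on the Lie algebra\<close>

fun act_series :: "'g set \<Rightarrow> nat \<Rightarrow> 'g set" where
  "act_series H 0 = UNIV"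
| "act_series H (Suc n) = span {br h v | h v. h \<in> H \<and> v \<in> act_series H n}"

text \<open>Stated for arbitrary sets, so that in the proof of Engel's theorem \<open>H\<close> can
  grow one vector at a time with no closure under \<open>br\<close> to maintain.\<close>

definition acts_nilpotently :: "'g set \<Rightarrow> bool" where
  "acts_nilpotently H \<longleftrightarrow> (\<exists>n. act_series H n = {0})"

lemma subspace_act_series: "subspace (act_series H n)"
  by (cases n) simp_all

lemma br_in_act_series: "h \<in> H \<Longrightarrow> v \<in> act_series H n \<Longrightarrow> br h v \<in> act_series H (Suc n)"
  by (auto intro!: span_base)

lemma act_series_antimono: "act_series H (Suc n) \<subseteq> act_series H n"
proof (induction n)
  case (Suc n)
  then show ?case
    by (auto intro!: span_mono)
qed simp

text \<open>The Leibniz rule splits \<open>br x (br h z)\<close> into \<open>br (br x h) z\<close>,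
  where \<open>br x h\<close> is again in \<open>H\<close>, and \<open>br h (br x z)\<close>, where
  the induction hypothesis applies to \<open>z\<close>.\<close>

lemma act_series_invariant:
  assumes norm: "\<And>h. h \<in> H \<Longrightarrow> br x h \<in> H"
  shows "v \<in> act_series H n \<Longrightarrow> br x v \<in> act_series H n"
proof (induction n arbitrary: v)
  case (Suc n)
  from Suc.prems have "v \<in> span {br h w | h w. h \<in> H \<and> w \<in> act_series H n}"
    by simp
  then show ?case
  proof (induction rule: span_induct_alt)
    case base
    then show ?case
      by (simp add: span_zero)
  next
    case (step c u w)
    then obtain h z where u: "u = br h z" and h: "h \<in> H" and z: "z \<in> act_series H n"
      by blast
    have "br x u \<in> act_series H (Suc n)"
      unfolding u br_derivation[of x]
      by (intro subspace_add[OF subspace_act_series] br_in_act_series norm h z Suc.IH)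
    then show ?case
      unfolding br_add_right br_scale_right
      using step.IH by (intro subspace_add[OF subspace_act_series]
        subspace_scale[OF subspace_act_series])
  qed
qed simp

text \<open>Each block of \<open>m\<close> steps in the series of the larger space costs one level
  in the series of \<open>H\<close>, because the part not yet one level down has by then become a
  value of \<open>br x ^^ m\<close>, which is zero.\<close>

lemma acts_nilpotently_insert:
  assumes H: "subspace H" "acts_nilpotently H"
    and norm: "\<And>h. h \<in> H \<Longrightarrow> br x h \<in> H"
    and x_nil: "\<And>v. (br x ^^ m) v = 0"
  shows "acts_nilpotently (span (insert x H))"
proof -
  let ?V = "act_series H" and ?W = "act_series (span (insert x H))"
  have pow_V: "(br x ^^ j) v \<in> ?V i" if "v \<in> ?V i" for i j v
    using that by (induction j) (auto intro: act_series_invariant[OF norm])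
  have pow_add: "(br x ^^ j) (u + v) = (br x ^^ j) u + (br x ^^ j) v" for j u v
    by (induction j) (simp_all add: br_add_right)
  have pow_scale: "(br x ^^ j) (scale c v) = scale c ((br x ^^ j) v)" for j c v
    by (induction j) (simp_all add: br_scale_right)
  \<comment> \<open>Modulo \<open>?V (Suc i)\<close> the elements of \<open>H\<close> annihilate
    \<open>?V i\<close>, so each of the \<open>j\<close> steps contributes just one factor
    \<open>br x\<close>.\<close>
  have step: "w \<in> {u + (br x ^^ j) v | u v. u \<in> ?V (Suc i) \<and> v \<in> ?V i}"
    if start: "?W k \<subseteq> ?V i" and w: "w \<in> ?W (k + j)" for i k j w
    using w
  proof (induction j arbitrary: w)
    case 0
    then have "w = 0 + (br x ^^ 0) w" "w \<in> ?V i"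
      using start by auto
    then show ?case
      using subspace_0[OF subspace_act_series] by blast
  next
    case (Suc j)
    let ?S = "{u + (br x ^^ Suc j) v | u v. u \<in> ?V (Suc i) \<and> v \<in> ?V i}"
    have w: "w \<in> span {br h v | h v. h \<in> span (insert x H) \<and> v \<in> ?W (k + j)}"
      using Suc.prems by simp
    \<comment> \<open>As a sum of two subspaces, \<open>?S\<close> is a subspace, so it suffices to
      check the generators of the span.\<close>
    have S_eq: "?S = {u + v | u v. u \<in> ?V (Suc i) \<and> v \<in> (br x ^^ Suc j) ` ?V i}"
      by blast
    have sub_img: "subspace ((br x ^^ Suc j) ` ?V i)"
    proof (rule subspaceI)
      show "0 \<in> (br x ^^ Suc j) ` ?V i"
        using subspace_0[OF subspace_act_series] pow_scale[of "Suc j" 0 0]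
        by (intro image_eqI[of _ _ 0]) auto
    next
      fix a b assume "a \<in> (br x ^^ Suc j) ` ?V i" "b \<in> (br x ^^ Suc j) ` ?V i"
      then show "a + b \<in> (br x ^^ Suc j) ` ?V i"
        unfolding image_iff using pow_add subspace_add[OF subspace_act_series] by metis
    next
      fix c a assume "a \<in> (br x ^^ Suc j) ` ?V i"
      then show "scale c a \<in> (br x ^^ Suc j) ` ?V i"
        unfolding image_iff using pow_scale subspace_scale[OF subspace_act_series] by metis
    qed
    have "subspace ?S"
      unfolding S_eq by (rule subspace_sums[OF subspace_act_series sub_img])
    moreover have "{br h v | h v. h \<in> span (insert x H) \<and> v \<in> ?W (k + j)} \<subseteq> ?S"
    proof clarify
      fix h v assume h: "h \<in> span (insert x H)" and "v \<in> ?W (k + j)"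
      then obtain a b where v: "v = a + (br x ^^ j) b" and a: "a \<in> ?V (Suc i)" and b: "b \<in> ?V i"
        using Suc.IH by blast
      obtain c h' where h': "h' \<in> H" and h_eq: "h = h' + scale c x"
        using h unfolding span_breakdown_eq span_eq_iff[THEN iffD2, OF H(1)]
        by (metis diff_add_cancel)
      have v_V: "v \<in> ?V i"
        unfolding v using a b act_series_antimono pow_V
        by (blast intro: subspace_add[OF subspace_act_series])
      \<comment> \<open>The component \<open>h'\<close> sends all of \<open>v\<close> one level
        down, while \<open>x\<close> keeps \<open>a\<close> in \<open>?V (Suc i)\<close> and adds
        one power of \<open>br x\<close> in front of \<open>b\<close>.\<close>
      have "br h v = (br h' v + scale c (br x a)) + (br x ^^ Suc j) (scale c b)"
        unfolding pow_scale
        by (simp add: h_eq v br_add_left br_add_right br_scale_left scale_right_distrib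
            algebra_simps)
      moreover have "br h' v + scale c (br x a) \<in> ?V (Suc i)"
        by (intro subspace_add[OF subspace_act_series] subspace_scale[OF subspace_act_series]
            br_in_act_series h' v_V act_series_invariant[OF norm] a)
      moreover have "scale c b \<in> ?V i"
        by (intro subspace_scale[OF subspace_act_series] b)
      ultimately show "\<exists>u va. br h v = u + (br x ^^ Suc j) va \<and> u \<in> ?V (Suc i) \<and> va \<in> ?V i"
        by blast
    qed
    ultimately show ?case
      using w span_minimal by blast
  qed
  have "?W (i * m) \<subseteq> ?V i" for i
  proof (induction i)
    case (Suc i)
    show ?case
    proof
      fix w assume "w \<in> ?W (Suc i * m)"
      then have "w \<in> ?W (i * m + m)"
        by (simp add: add.commute)
      then show "w \<in> ?V (Suc i)"
        using step[OF Suc.IH, of w m] by (auto simp only: x_nil add_0_right)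
    qed
  qed simp
  then show ?thesis
    using H(2) subspace_0[OF subspace_act_series] unfolding acts_nilpotently_def by blast
qed

section \<open>Engel's theorem\<close>

lemma exists_normalizing:
  assumes "subspace H" "acts_nilpotently H" "H \<noteq> UNIV"
  obtains x where "x \<notin> H" "\<And>h. h \<in> H \<Longrightarrow> br x h \<in> H"
proof -
  obtain n where n: "act_series H n = {0}"
    using assms(2) acts_nilpotently_def by blast
  have "\<exists>x. x \<notin> H \<and> (\<forall>h\<in>H. br h x \<in> H)"
  proof (rule ccontr)
    assume no: "\<not> ?thesis"
    \<comment> \<open>Under the negated claim every vector outside \<open>H\<close> is sent outside
      \<open>H\<close> by some element of \<open>H\<close>; iterating this reaches every level of
      the series, including the one that is zero.\<close>
    have "\<exists>x. x \<notin> H \<and> x \<in> act_series H k" for k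
    proof (induction k)
      case 0
      then show ?case
        using assms(3) by auto
    next
      case (Suc k)
      then show ?case
        using no br_in_act_series by blast
    qed
    from this[of n] show False
      using n subspace_0[OF assms(1)] by auto
  qed
  \<comment> \<open>Anticommutativity swaps the two arguments, and \<open>H\<close> is closed under
    negation.\<close>
  then show ?thesis
    using that br_anticomm subspace_neg[OF assms(1)] by metis
qed

theorem engel:
  assumes fin: "finite_dimensional_vector_space scale B"
    and nil: "\<And>a. \<exists>n. \<forall>v. (br a ^^ n) v = 0"
  shows "acts_nilpotently UNIV"
proof -
  interpret fd: finite_dimensional_vector_space scale B
    by (fact fin)
  let ?P = "\<lambda>H. subspace H \<and> acts_nilpotently H"
  have "{br h v | h v. h \<in> {0} \<and> v \<in> act_series {0} 0} = {0}"
    by auto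
  then have "act_series {0} (Suc 0) = {0}"
    using span_eq_iff[THEN iffD2, OF subspace_single_0] by simp
  then have "?P {0}"
    using subspace_single_0 acts_nilpotently_def by blast
  \<comment> \<open>Finite dimension bounds the dimensions, so some \<open>H\<close> attains the
    greatest one; the zero subspace is the initial candidate.\<close>
  moreover have "\<forall>H. ?P H \<longrightarrow> dim H < Suc (dim UNIV)"
    using fd.dim_subset[OF subset_UNIV] by (simp add: less_Suc_eq_le)
  ultimately have "\<exists>H. ?P H \<and> (\<forall>H'. ?P H' \<longrightarrow> dim H' \<le> dim H)"
    by (rule ex_has_greatest_nat[where k = "{0}" and f = dim])
  then obtain H where H: "?P H" and max: "\<And>H'. ?P H' \<Longrightarrow> dim H' \<le> dim H"
    by blast
  have "H = UNIV"
  proof (rule ccontr)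
    assume "H \<noteq> UNIV"
    then obtain x where x: "x \<notin> H" "\<And>h. h \<in> H \<Longrightarrow> br x h \<in> H"
      using H exists_normalizing by blast
    have "?P (span (insert x H))"
      using acts_nilpotently_insert[OF _ _ x(2)] H nil[of x] by auto
    then have "dim (span (insert x H)) \<le> dim H"
      by (rule max)
    moreover have "H \<subseteq> span (insert x H)"
      using span_superset by blast
    ultimately have "H = span (insert x H)"
      using H fd.subspace_dim_equal subspace_span by blast
    then show False
      using x(1) span_base[of x "insert x H"] by blast
  qed
  then show ?thesis
    using H by blast
qed

section \<open>Affine hulls and the affine lower central series\<close>

lemma affine_hull_translate:
  assumes "0 \<in> S"
  shows "affine_subspace (affgebra_of scale br \<kappa> lam s) hull ((\<lambda>x. x + t) ` S)
    = (\<lambda>x. x + t) ` span S" (is "?A hull _ = _")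
proof (rule hull_unique)
  show "(\<lambda>x. x + t) ` S \<subseteq> (\<lambda>x. x + t) ` span S"
    using span_superset by (intro image_mono)
  show "?A ((\<lambda>x. x + t) ` span S)"
    unfolding affine_subspace_def affgebra_of_def affgebra.simps
  proof (intro conjI ballI allI)
    fix x y z assume "x \<in> (\<lambda>x. x + t) ` span S" "y \<in> (\<lambda>x. x + t) ` span S" "z \<in> (\<lambda>x. x + t) ` span S"
    then obtain a b c where "x = a + t" "y = b + t" "z = c + t"
      and "a \<in> span S" "b \<in> span S" "c \<in> span S"
      by blast
    then show "x - y + z \<in> (\<lambda>x. x + t) ` span S"
      by (intro image_eqI[of _ _ "a - b + c"] span_add span_diff) auto
  next
    fix \<alpha> x y assume "x \<in> (\<lambda>x. x + t) ` span S" "y \<in> (\<lambda>x. x + t) ` span S"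
    then obtain a b where "x = a + t" "y = b + t" and "a \<in> span S" "b \<in> span S"
      by blast
    then show "scale (1 - \<alpha>) x + scale \<alpha> y \<in> (\<lambda>x. x + t) ` span S"
      by (intro image_eqI[of _ _ "scale (1 - \<alpha>) a + scale \<alpha> b"] span_add span_scale)
        (auto simp: algebra_simps)
  qed
next
  fix T assume sub: "(\<lambda>x. x + t) ` S \<subseteq> T" and T: "?A T"
  have heap: "a - b + c \<in> T" if "a \<in> T" "b \<in> T" "c \<in> T" for a b c
    using T that unfolding affine_subspace_def affgebra_of_def by simp
  have act: "scale (1 - \<alpha>) a + scale \<alpha> b \<in> T" if "a \<in> T" "b \<in> T" for \<alpha> a b
    using T that unfolding affine_subspace_def affgebra_of_def by simp
  have t: "t \<in> T"
    using sub assms by force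
  \<comment> \<open>With \<open>t\<close> as origin, addition is the heap operation with middle
    entry \<open>t\<close>, and scaling is the action based at \<open>t\<close>.\<close>
  have "subspace {x. x + t \<in> T}"
  proof (rule subspaceI; clarsimp simp: t)
    fix x y assume "x + t \<in> T" "y + t \<in> T"
    from heap[OF this(1) t this(2)] show "x + y + t \<in> T"
      by (simp add: algebra_simps)
  next
    fix c x assume "x + t \<in> T"
    from act[OF t this, of c] show "scale c x + t \<in> T"
      by (simp add: algebra_simps)
  qed
  moreover have "S \<subseteq> {x. x + t \<in> T}"
    using sub by blast
  ultimately have "span S \<subseteq> {x. x + t \<in> T}"
    by (intro span_minimal)
  then show "(\<lambda>x. x + t) ` span S \<subseteq> T"
    by blast
qed

text \<open>Since \<open>s\<close> is central, \<open>bracket A h (v + s) = br h v + s\<close>, so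
  the generators at each level are translates by \<open>s\<close> of the linear ones. Zero is among
  the latter, hence the affine hull is the translated span.\<close>

lemma lower_series_central_translate:
  assumes s: "\<And>x. br x s = 0"
    and A: "A = affgebra_of scale br (\<lambda>x. 0) (\<lambda>x. 0) s"
  shows "lower_series A n = (\<lambda>x. x + s) ` act_series UNIV n"
proof (induction n)
  case 0
  show ?case
    using surj_diff_right by (auto intro: range_eqI[of _ _ "_ - s"])
next
  case (Suc n)
  have br_A: "bracket A h (v + s) = br h v + s" for h v
    unfolding A affgebra_of_def by (simp add: br_add_right s)
  have "{bracket A x y | x y. x \<in> UNIV \<and> y \<in> lower_series A n}
      = (\<lambda>x. x + s) ` {br h v | h v. h \<in> UNIV \<and> v \<in> act_series UNIV n}"
    unfolding Suc.IH
  proof (intro subset_antisym subsetI; elim imageE CollectE exE conjE)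
    fix w x y z assume "w = bracket A x y" "y = z + s" "z \<in> act_series UNIV n"
    then show "w \<in> (\<lambda>x. x + s) ` {br h v | h v. h \<in> UNIV \<and> v \<in> act_series UNIV n}"
      by (intro image_eqI[of _ _ "br x z"]) (auto simp: br_A)
  next
    fix w u h v assume "w = u + s" "u = br h v" "v \<in> act_series UNIV n"
    then show "w \<in> {bracket A x y | x y. x \<in> UNIV \<and> y \<in> (\<lambda>x. x + s) ` act_series UNIV n}"
      by (intro CollectI exI[of _ h] exI[of _ "v + s"]) (auto simp: br_A)
  qed
  moreover have "0 \<in> {br h v | h v. h \<in> UNIV \<and> v \<in> act_series UNIV n}"
    using subspace_0[OF subspace_act_series]
    by (intro CollectI exI[of _ 0]) auto
  ultimately show ?case
    using affine_hull_translate unfolding A by (simp add: set_bracket_def)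
qed

end

section \<open>Vanishing of \<open>lam\<close> and reduction to Engel's theorem\<close>

theorem theorem7p7:
  fixes scale :: "'k::field \<Rightarrow> 'g::ab_group_add \<Rightarrow> 'g"
    and br :: "'g \<Rightarrow> 'g \<Rightarrow> 'g"
    and \<kappa> lam :: "'g \<Rightarrow> 'g"
    and s :: 'g
    and Basis :: "'g set"
  assumes lie: "lie_algebra scale br"
    and fin_dim: "finite_dimensional_vector_space scale Basis"
    and char: "CHAR('k) \<noteq> 2"
    and lam_linear: "Vector_Spaces.linear scale scale lam"
    and kappa: "\<kappa> = (\<lambda>x. scale 2 (lam x))"
    and compat: "\<And>a b. lam (br a b) = br (lam a) b + br a (lam b) - br a (\<kappa> b)"
    and br_lam: "\<And>x y. br x (lam y) = 0"
    and ad_s: "ad br s = (\<lambda>x. 0)"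
    and ad_nil: "\<And>a. affinely_ad_nilpotent (affgebra_of scale br \<kappa> lam s) a"
  shows "affinely_nilpotent (affgebra_of scale br \<kappa> lam s)"
proof -
  interpret lie_algebra scale br
    by (fact lie)
  have s: "br x s = 0" for x
    using fun_cong[OF ad_s, of x] br_anticomm[of x s] unfolding ad_def by simp
  have two: "(2 :: 'k) \<noteq> 0"
  proof
    assume "(2 :: 'k) = 0"
    then have "of_nat 2 = (0 :: 'k)"
      by simp
    then have "CHAR('k) dvd 2"
      by (simp only: of_nat_eq_0_iff_char_dvd)
    moreover from this have "CHAR('k) \<le> 2"
      by (rule dvd_imp_le) simp
    moreover have "CHAR('k) \<noteq> 1"
      using CHAR_not_1 by auto
    ultimately show False
      using char by (cases "CHAR('k) = 0") auto
  qed
  have lam_0: "lam 0 = 0" and lam_diff: "lam (x - y) = lam x - lam y" for x y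
    using lam_linear module_hom.zero module_hom.diff linear_iff_module_hom by metis+
  have "lam a = 0" for a
  proof -
    obtain x where "x \<in> absorbing (affgebra_of scale br \<kappa> lam s)"
      using ad_nil unfolding affinely_ad_nilpotent_def by blast
    then have eqs: "br x b + scale 2 (lam x) + lam (b - x) + s = x"
        "br b x + scale 2 (lam b) + lam (x - b) + s = x" for b
      unfolding absorbing_def affgebra_of_def kappa by auto
    have *: "scale 2 y = y + y" for y
      by (metis one_add_one scale_left_distrib scale_one)
    \<comment> \<open>Evaluating at 0 identifies the constant terms of both equations with
      \<open>x\<close>, so they cancel below; adding what remains removes the bracket and leaves
      \<open>2 lam a = 0\<close>.\<close>
    have x: "x = lam x + s"
      using eqs(1)[of 0] lam_diff[of 0 x] by (simp add: * lam_0)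
    have "br x a + lam a + (lam x + s) = x" "br a x + lam a + (lam x + s) = x"
      using eqs[of a] by (simp_all add: * lam_diff algebra_simps)
    then have "br x a + lam a = 0" "br a x + lam a = 0"
      unfolding x[symmetric] by simp_all
    then have "scale 2 (lam a) = 0"
      unfolding * using br_anticomm[of a x] by (simp add: add_eq_0_iff)
    then show ?thesis
      using two by simp
  qed
  then have lam: "lam = (\<lambda>x. 0)" and kap: "\<kappa> = (\<lambda>x. 0)"
    unfolding kappa by auto
  define A where "A = affgebra_of scale br (\<lambda>x. 0) (\<lambda>x. 0) s"
  have br_A: "bracket A = (\<lambda>a b. br a b + s)"
    unfolding A_def affgebra_of_def by simp
  have nil: "affinely_ad_nilpotent A a" for a
    using ad_nil unfolding A_def lam kap .
  have E: "absorbing A = {s}"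
  proof -
    obtain e where e: "absorbing A = {e}"
      using nil unfolding affinely_ad_nilpotent_def by blast
    then have "e \<in> absorbing A"
      by blast
    \<comment> \<open>Testing the absorbing element against 0 forces it to be
      \<open>s\<close>.\<close>
    then have "br e 0 + s = e"
      unfolding absorbing_def br_A by blast
    then show ?thesis
      using e by simp
  qed
  \<comment> \<open>Translation by the central \<open>s\<close> conjugates \<open>br a\<close> to
    \<open>ad_aff A a\<close>, so ad-nilpotency transfers between them.\<close>
  have ad_pow: "(ad_aff A a ^^ n) (x + s) = (br a ^^ n) x + s" for a n x
    by (induction n) (simp_all add: ad_aff_def br_A br_add_right s)
  have "\<exists>n. \<forall>v. (br a ^^ n) v = 0" for a
  proof -
    obtain n where "\<And>x. (ad_aff A a ^^ n) x = s"
      using nil[of a] E unfolding affinely_ad_nilpotent_def by auto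
    then have "(br a ^^ n) v + s = s" for v
      using ad_pow by metis
    then show ?thesis
      by auto
  qed
  then obtain n where n: "act_series UNIV n = {0}"
    using engel[OF fin_dim] unfolding acts_nilpotently_def by blast
  \<comment> \<open>Affine nilpotency asks for a positive index, whereas \<open>n\<close> may be 0
    when the Lie algebra is zero; hence \<open>Suc n\<close>.\<close>
  have "act_series UNIV (Suc n + k) = {0}" for k
  proof -
    have "act_series UNIV (n + k) \<subseteq> act_series UNIV n" for k
      using act_series_antimono by (induction k) fastforce+
    from this[of "Suc k"] show ?thesis
      using n subspace_0[OF subspace_act_series, of UNIV "Suc n + k"] by auto
  qed
  then have "lower_series A (Suc n + k) = {s}" for k
    by (simp only: lower_series_central_translate[OF s A_def] image_insert image_empty add_0_left)
  then have "affinely_nilpotent A"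
    unfolding affinely_nilpotent_def E
    by (metis add_0_right zero_less_Suc)
  then show ?thesis
    unfolding A_def lam kap .
qed

end
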